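(* Assume that $\varphi$ is differentiable. Let $\Omega$ be a subset of $\mathcal{M}$ and let $Q^*\in\Omega\cap\mathrm{dom}\,\phi$; write $q^*:=\frac{dQ^*}{dP}$ and, for $Q\in\mathrm{dom}\,\phi$, $q:=\frac{dQ}{dP}$. Consider the two conditions, required for all $Q\in\Omega\cap\mathrm{dom}\,\phi$: (i) $\varphi'(q^* )q\in L_1(\mathcal{X},P)$; (ii) $\int\varphi'(q^* )\,dQ^*\le\int\varphi'(q^* )\,dQ$. Then: (1) Conditions (i) and (ii) together are sufficient for $Q^*$ to be a $\phi$-projection of $P$ on $\Omega$. (2) Suppose that $\Omega$ is convex and that there exists $0<\delta<1$ such that for all $c\in[1-\delta,1+\delta]$ one can find numbers $c_1,c_2,c_3$ with $\varphi(cx)\le c_1\varphi(x)+c_2|x|+c_3$ for all real $x$. Then conditions (i) and (ii) are also necessary for $Q^*$ to be a $\phi$-projection of $P$ on $\Omega$.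
   Context: $(\mathcal{X},\mathcal{B})$ is a measurable space and $P$ a given probability measure on it. $\mathcal{M}$ is the real vector space of all signed finite measures on $(\mathcal{X},\mathcal{B})$, and $\mathcal{M}(P)$ the subspace of those absolutely continuous w.r.t. $P$. The function $\varphi:\mathbb{R}\to[0,+\infty]$ is proper, convex and closed, with $\varphi(1)=0$, and its domain $\{x:\varphi(x)<\infty\}$ is an interval with endpoints $a_\varphi<1<b_\varphi$ (finite or infinite). Closed means that $\varphi(x)\to\varphi(a_\varphi)$ as $x\downarrow a_\varphi$ if $a_\varphi$ is finite, and $\varphi(x)\to\varphi(b_\varphi)$ as $x\uparrow b_\varphi$ if $b_\varphi$ is finite (equivalently, $\varphi$ is lower semi-continuous). "Differentiable" means differentiable on $]a_\varphi,b_\varphi[$; then $\varphi'(a_\varphi)$ and $\varphi'(b_\varphi)$ denote the (finite or infinite) limits of $\varphi'(x)$ as $x\downarrow a_\varphi$ and $x\uparrow b_\varphi$. The usual convention $0\cdot(\pm\infty)=0$ is used for products, and $\int\varphi'(q^* )\,dQ=\int\varphi'(q^* )q\,dP$. For $Q\in\mathcal{M}(P)$ put $\phi(Q,P):=\int_{\mathcal{X}}\varphi\left(\frac{dQ}{dP}\right)dP$, and $\phi(Q,P):=+\infty$ if $Q\in\mathcal{M}\setminus\mathcal{M}(P)$. $\mathrm{dom}\,\phi:=\{Q\in\mathcal{M}:\phi(Q,P)<\infty\}$. When $\inf_{Q\in\Omega}\phi(Q,P)<\infty$, a $\phi$-projection of $P$ on $\Omega$ is a measure $Q^*\in\Omega$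 such that $\phi(Q^*,P)\le\phi(Q,P)$ for all $Q\in\Omega$. *)

theory Defs
  imports "HOL-Probability.Probability"
begin

section \<open>Signed finite measures\<close>

text \<open>A signed finite measure on the measurable space underlying \<open>M\<close> is a set function on
  \<open>sets M\<close>; as HOL functions are total, it is given the dummy value 0 off \<open>sets M\<close>, so that equality
  of signed measures is equality of functions. Only \<open>sets M\<close> matters, not the measure \<open>M\<close> carries.\<close>

definition signed_measures :: "'a measure \<Rightarrow> ('a set \<Rightarrow> real) set" where
  "signed_measures M = {Q. Q {} = 0
     \<and> (\<forall>A. A \<notin> sets M \<longrightarrow> Q A = 0)
     \<and> (\<forall>A :: nat \<Rightarrow> 'a set. range A \<subseteq> sets M \<and> disjoint_family A \<longrightarrow> (\<lambda>n. Q (A n)) sums Q (\<Union>n. A n))}"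

definition ac_signed_measures :: "'a measure \<Rightarrow> ('a set \<Rightarrow> real) set" where
  "ac_signed_measures P = {Q \<in> signed_measures P. \<forall>A\<in>null_sets P. Q A = 0}"

text \<open>The density dQ/dP. For a finite measure \<open>P\<close> and \<open>Q \<in> ac_signed_measures P\<close> it exists, and is
  unique up to \<open>P\<close>-null sets, by the Radon-Nikodym theorem.\<close>

definition signed_RN_deriv :: "'a measure \<Rightarrow> ('a set \<Rightarrow> real) \<Rightarrow> 'a \<Rightarrow> real" where
  "signed_RN_deriv P Q = (SOME f. integrable P f \<and> (\<forall>A\<in>sets P. Q A = (LINT x:A|P. f x)))"

text \<open>The function type is not an instance of \<open>real_vector\<close>, hence \<open>convex\<close> is not available here.\<close>

definition convex_measure_set :: "('a set \<Rightarrow> real) set \<Rightarrow> bool" where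
  "convex_measure_set \<Omega> \<longleftrightarrow>
     (\<forall>Q\<^sub>1\<in>\<Omega>. \<forall>Q\<^sub>2\<in>\<Omega>. \<forall>t\<in>{0..1::real}. (\<lambda>A. (1 - t) * Q\<^sub>1 A + t * Q\<^sub>2 A) \<in> \<Omega>)"

section \<open>The function \<open>\<phi>\<close>\<close>

definition eff_domain :: "(real \<Rightarrow> ennreal) \<Rightarrow> real set" where
  "eff_domain \<phi> = {x. \<phi> x < \<infinity>}"

definition lower_end :: "(real \<Rightarrow> ennreal) \<Rightarrow> ereal" where
  "lower_end \<phi> = (INF x\<in>eff_domain \<phi>. ereal x)"

definition upper_end :: "(real \<Rightarrow> ennreal) \<Rightarrow> ereal" where
  "upper_end \<phi> = (SUP x\<in>eff_domain \<phi>. ereal x)"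

definition convex_ext :: "(real \<Rightarrow> ennreal) \<Rightarrow> bool" where
  "convex_ext \<phi> \<longleftrightarrow> (\<forall>x y. \<forall>t\<in>{0..1}.
     \<phi> ((1 - t) * x + t * y) \<le> ennreal (1 - t) * \<phi> x + ennreal t * \<phi> y)"

definition closed_ext :: "(real \<Rightarrow> ennreal) \<Rightarrow> bool" where
  "closed_ext \<phi> \<longleftrightarrow>
     (\<forall>a. lower_end \<phi> = ereal a \<longrightarrow> (\<phi> \<longlongrightarrow> \<phi> a) (at_right a)) \<and>
     (\<forall>b. upper_end \<phi> = ereal b \<longrightarrow> (\<phi> \<longlongrightarrow> \<phi> b) (at_left b))"

text \<open>Properness is implied by \<open>\<phi> 1 = 0\<close>, and nonnegativity by the type \<open>ennreal\<close>.\<close>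

definition divergence_function :: "(real \<Rightarrow> ennreal) \<Rightarrow> bool" where
  "divergence_function \<phi> \<longleftrightarrow> convex_ext \<phi> \<and> closed_ext \<phi> \<and> \<phi> 1 = 0
     \<and> is_interval (eff_domain \<phi>) \<and> lower_end \<phi> < 1 \<and> 1 < upper_end \<phi>"

definition differentiable_divergence :: "(real \<Rightarrow> ennreal) \<Rightarrow> bool" where
  "differentiable_divergence \<phi> \<longleftrightarrow>
     (\<lambda>x. enn2real (\<phi> x)) differentiable_on einterval (lower_end \<phi>) (upper_end \<phi>)"

text \<open>The derivative, extended to finite endpoints by its one-sided limits there, which may be
  infinite; the value 0 beyond the endpoints is a dummy.\<close>

definition phi_deriv :: "(real \<Rightarrow> ennreal) \<Rightarrow> real \<Rightarrow> ereal" where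
  "phi_deriv \<phi> x =
     (let d = (\<lambda>y. ereal (deriv (\<lambda>z. enn2real (\<phi> z)) y)) in
      if lower_end \<phi> < ereal x \<and> ereal x < upper_end \<phi> then d x
      else if ereal x = lower_end \<phi> then Lim (at_right x) d
      else if ereal x = upper_end \<phi> then Lim (at_left x) d
      else 0)"

section \<open>Integrals of extended real functions\<close>

definition ext_L1 :: "'a measure \<Rightarrow> ('a \<Rightarrow> ereal) \<Rightarrow> bool" where
  "ext_L1 P f \<longleftrightarrow> f \<in> borel_measurable P \<and> (\<integral>\<^sup>+x. e2ennreal \<bar>f x\<bar> \<partial>P) < \<infinity>"

text \<open>\<open>e2ennreal\<close> maps negative values to 0, so the two terms are the integrals of the positive and
  of the negative part.\<close>

definition ext_integral :: "'a measure \<Rightarrow> ('a \<Rightarrow> ereal) \<Rightarrow> ereal" where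
  "ext_integral P f =
     enn2ereal (\<integral>\<^sup>+x. e2ennreal (f x) \<partial>P) - enn2ereal (\<integral>\<^sup>+x. e2ennreal (- f x) \<partial>P)"

text \<open>The integral of \<open>f\<close> with respect to \<open>Q\<close>. In \<open>ereal\<close>, 0 times an infinite value is 0.\<close>

definition signed_integral :: "'a measure \<Rightarrow> ('a set \<Rightarrow> real) \<Rightarrow> ('a \<Rightarrow> ereal) \<Rightarrow> ereal" where
  "signed_integral P Q f = ext_integral P (\<lambda>x. f x * ereal (signed_RN_deriv P Q x))"

section \<open>Divergences and projections\<close>

definition phi_divergence :: "(real \<Rightarrow> ennreal) \<Rightarrow> 'a measure \<Rightarrow> ('a set \<Rightarrow> real) \<Rightarrow> ennreal" where
  "phi_divergence \<phi> P Q =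
     (if Q \<in> ac_signed_measures P then \<integral>\<^sup>+x. \<phi> (signed_RN_deriv P Q x) \<partial>P else \<infinity>)"

definition phi_dom :: "(real \<Rightarrow> ennreal) \<Rightarrow> 'a measure \<Rightarrow> ('a set \<Rightarrow> real) set" where
  "phi_dom \<phi> P = {Q \<in> signed_measures P. phi_divergence \<phi> P Q < \<infinity>}"

definition is_phi_projection ::
  "(real \<Rightarrow> ennreal) \<Rightarrow> 'a measure \<Rightarrow> ('a set \<Rightarrow> real) set \<Rightarrow> ('a set \<Rightarrow> real) \<Rightarrow> bool" where
  "is_phi_projection \<phi> P \<Omega> Q' \<longleftrightarrow>
     (INF Q\<in>\<Omega>. phi_divergence \<phi> P Q) < \<infinity> \<and> Q' \<in> \<Omega> \<and>
     (\<forall>Q\<in>\<Omega>. phi_divergence \<phi> P Q' \<le> phi_divergence \<phi> P Q)"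

end

theory Submission
  imports Defs
begin

text \<open>Write \<open>q\<^sup>*\<close> and \<open>q\<close> for the densities of \<open>Qstar\<close> and \<open>Q\<close>, and \<open>g\<close> for the slope of \<open>\<phi>\<close>
  at \<open>q\<^sup>*\<close>. Everything rests on the tangent inequality \<open>\<phi>(q) \<ge> \<phi>(q\<^sup>*) + g * (q - q\<^sup>*)\<close> for a
  convex function, valid also at a finite endpoint of the domain because \<open>\<phi>\<close> is closed
  (\<open>tangent\<close>).

  Sufficiency: if \<open>g * q\<close> and \<open>g * q\<^sup>*\<close> are integrable, integrate the tangent inequality; condition
  (ii) says that the linear term contributes a nonnegative amount.

  Necessity: on the segment from \<open>Qstar\<close> to \<open>Q\<close> the divergence is a convex function of the parameter
  with a minimum at 0, so its right derivative there is nonnegative. This derivative is the integral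
  of \<open>g * (q - q\<^sup>*)\<close>: the difference quotients of \<open>\<phi>\<close> converge pointwise
  (\<open>difference_quotient_limit\<close>) and are bounded above by an integrable function, so Fatou's lemma
  applies (\<open>directional_derivative_nonneg\<close>). To split the integral into its two parts one needs
  integrability of \<open>g * q\<^sup>*\<close>; it comes from the tangent inequality between \<open>q\<^sup>*\<close> and
  \<open>(1 \<plusminus> \<delta>) * q\<^sup>*\<close> together with the growth condition (\<open>scaling_bound\<close>).

  The slope is infinite at most at an endpoint of the domain. In the sufficiency part, finiteness of
  the two products forces \<open>q = q\<^sup>* = 0\<close> there. In the necessity part, the growth condition makes the
  domain stable under multiplication by \<open>1 \<plusminus> \<delta>\<close>, so that 0 is the only possible endpoint in it, and
  integrability of \<open>g * (q - q\<^sup>*)\<close> then forces \<open>q = 0\<close> almost everywhere where \<open>q\<^sup>* = 0\<close> and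
  the slope is infinite.

  That the densities exist, and depend affinely on the signed measure up to null sets, requires the
  Radon-Nikodym theorem for signed measures; it is reduced to the theorem for finite measures by a
  Hahn decomposition (\<open>Hahn_decomposition\<close>, \<open>signed_RN_deriv_is_density\<close>).\<close>

section \<open>Hahn decomposition of a signed measure\<close>

lemma signed_measure_sums:
  assumes "Q \<in> signed_measures M" "range A \<subseteq> sets M" "disjoint_family A"
  shows "(\<lambda>n::nat. Q (A n)) sums Q (\<Union>n. A n)"
  using assms unfolding signed_measures_def by blast

lemma signed_measure_empty: "Q \<in> signed_measures M \<Longrightarrow> Q {} = 0"
  unfolding signed_measures_def by blast

lemma signed_measure_Un:
  assumes Q: "Q \<in> signed_measures M" and "A \<in> sets M" "B \<in> sets M" "A \<inter> B = {}"
  shows "Q (A \<union> B) = Q A + Q B"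
proof -
  have "(\<lambda>n. Q (binaryset A B n)) sums Q (\<Union>n. binaryset A B n)"
    using assms by (intro signed_measure_sums[OF Q])
      (auto simp: range_binaryset_eq disjoint_family_on_def binaryset_def)
  moreover have "(\<lambda>n. Q (binaryset A B n)) sums (Q A + Q B)"
    by (rule binaryset_sums) (rule signed_measure_empty[OF Q])
  ultimately show ?thesis
    by (metis UN_binaryset_eq sums_unique2)
qed

lemma uminus_signed_measure:
  assumes "Q \<in> signed_measures M"
  shows "(\<lambda>A. - Q A) \<in> signed_measures M"
  using assms unfolding signed_measures_def by (auto intro!: sums_minus)

text \<open>Choose disjoint members of \<open>\<F>\<close> one after the other, each of them taking, up to a factor 2
  and a cap at 1, the largest value of \<open>Q\<close> still available. The chosen values form a convergent
  series, so they tend to 0; whatever member of \<open>\<F>\<close> is left over at the end was available at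
  every step, hence cannot have a positive value. The cap replaces a proof that \<open>Q\<close> is bounded. The
  lemma is applied twice below, with different families and signs.\<close>
lemma greedy_exhaustion:
  assumes Q: "Q \<in> signed_measures M" and F: "\<F> \<subseteq> sets M" "{} \<in> \<F>"
  obtains B :: "nat \<Rightarrow> 'a set" where "range B \<subseteq> \<F>" "disjoint_family B" "\<And>n. 0 \<le> Q (B n)"
    "\<And>C. C \<in> \<F> \<Longrightarrow> C \<inter> (\<Union>n. B n) = {} \<Longrightarrow> Q C \<le> 0"
proof -
  define good where "good R B \<longleftrightarrow> B \<in> \<F> \<and> B \<inter> R = {} \<and> 0 \<le> Q B \<and>
     (\<forall>C\<in>\<F>. C \<inter> R = {} \<longrightarrow> min (Q C / 2) 1 \<le> Q B)" for R B
  \<comment> \<open>Capping at 2 makes the supremum finite; halving it leaves room for a set that attains the bound.\<close>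
  have "\<exists>B. good R B" for R
  proof -
    define K where "K = {C\<in>\<F>. C \<inter> R = {}}"
    define s where "s = (SUP C\<in>K. min (Q C) 2)"
    have e: "{} \<in> K" "Q {} = 0"
      using F signed_measure_empty[OF Q] by (auto simp: K_def)
    have bdd: "bdd_above ((\<lambda>C. min (Q C) 2) ` K)"
      by (rule bdd_aboveI[of _ 2]) auto
    have le_s: "min (Q C) 2 \<le> s" if "C \<in> K" for C
      unfolding s_def by (rule cSUP_upper[OF that bdd])
    have s2: "s \<le> 2"
      unfolding s_def using e by (intro cSUP_least) auto
    have s0: "0 \<le> s" using le_s[OF e(1)] e(2) by simp
    have "\<exists>B\<in>K. 0 \<le> Q B \<and> s / 2 \<le> Q B"
    proof (cases "s = 0")
      case True then show ?thesis using e by (intro bexI[of _ "{}"]) auto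
    next
      case False
      then have "s / 2 < s" using s0 by simp
      then obtain B where "B \<in> K" "s / 2 < min (Q B) 2"
        using less_cSUP_iff[OF _ bdd, of "s/2"] e unfolding s_def by auto
      then show ?thesis using s0 by (intro bexI[of _ B]) auto
    qed
    then obtain B where "B \<in> K" "0 \<le> Q B" "s / 2 \<le> Q B" by blast
    moreover have "min (Q C / 2) 1 \<le> s / 2" if "C \<in> K" for C
      using le_s[OF that] by (simp add: min_def split: if_splits)
    ultimately show ?thesis
      unfolding good_def K_def by (intro exI[of _ B]) force
  qed
  then obtain G where G: "\<And>R. good R (G R)" by metis
  define R where "R = rec_nat {} (\<lambda>_ r. r \<union> G r)"
  define B where "B n = G (R n)" for n
  have R_Suc: "R (Suc n) = R n \<union> B n" for n
    by (simp add: R_def B_def)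
  have B: "B n \<in> \<F>" "B n \<inter> R n = {}" "0 \<le> Q (B n)"
    "\<And>C. C \<in> \<F> \<Longrightarrow> C \<inter> R n = {} \<Longrightarrow> min (Q C / 2) 1 \<le> Q (B n)" for n
    using G[of "R n"] unfolding good_def B_def by auto
  have R_eq: "R n = (\<Union>i<n. B i)" for n
    by (induction n) (auto simp: R_Suc lessThan_Suc, simp add: R_def)
  have disj: "disjoint_family B"
  proof (unfold disjoint_family_on_def, intro ballI impI)
    fix m n :: nat assume "m \<noteq> n"
    then consider "m < n" | "n < m" by linarith
    then show "B m \<inter> B n = {}"
      using B(2)[of n] B(2)[of m] by cases (auto simp: R_eq)
  qed
  have "(\<lambda>n. Q (B n)) sums Q (\<Union>n. B n)"
    using signed_measure_sums[OF Q _ disj] B(1) F by blast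
  then have lim: "(\<lambda>n. Q (B n)) \<longlonglongrightarrow> 0"
    by (intro summable_LIMSEQ_zero sums_summable)
  have "Q C \<le> 0" if C: "C \<in> \<F>" "C \<inter> (\<Union>n. B n) = {}" for C
  proof -
    have "min (Q C / 2) 1 \<le> Q (B n)" for n
      using C by (intro B(4)) (auto simp: R_eq)
    then have "min (Q C / 2) 1 \<le> 0"
      by (intro LIMSEQ_le_const[OF lim]) auto
    then show ?thesis by (auto simp: min_def split: if_splits)
  qed
  then show thesis using that[of B] B disj by blast
qed

definition positive_set :: "'a measure \<Rightarrow> ('a set \<Rightarrow> real) \<Rightarrow> 'a set \<Rightarrow> bool" where
  "positive_set M Q A \<longleftrightarrow> A \<in> sets M \<and> (\<forall>D\<in>sets M. D \<subseteq> A \<longrightarrow> 0 \<le> Q D)"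

text \<open>Exhausting the negative part: removing from \<open>E\<close> a greedy sequence of subsets of nonpositive value
  does not decrease \<open>Q\<close>, and leaves a set without subsets of negative value.\<close>
lemma positive_subset:
  assumes Q: "Q \<in> signed_measures M" and E: "E \<in> sets M"
  obtains A where "A \<subseteq> E" "positive_set M Q A" "Q E \<le> Q A"
proof -
  obtain B :: "nat \<Rightarrow> _" where B: "range B \<subseteq> {C \<in> sets M. C \<subseteq> E}" "disjoint_family B"
      "\<And>n. 0 \<le> - Q (B n)"
      "\<And>C. C \<in> {C \<in> sets M. C \<subseteq> E} \<Longrightarrow> C \<inter> (\<Union>n. B n) = {} \<Longrightarrow> - Q C \<le> 0"
    by (rule greedy_exhaustion[OF uminus_signed_measure[OF Q], of "{C \<in> sets M. C \<subseteq> E}"]) auto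
  define U where "U = (\<Union>n. B n)"
  have U: "U \<in> sets M" "U \<subseteq> E" using B(1) unfolding U_def by auto
  have "(\<lambda>n. Q (B n)) sums Q U"
    unfolding U_def using B(1) by (intro signed_measure_sums[OF Q _ B(2)]) auto
  then have "Q U \<le> 0"
    by (rule sums_le[OF _ _ sums_zero, rotated]) (use B(3) in auto)
  moreover have "Q E = Q (E - U) + Q U"
    using signed_measure_Un[OF Q, of "E - U" U] U E by (auto simp: Un_absorb2)
  ultimately have "Q E \<le> Q (E - U)" by simp
  moreover have "positive_set M Q (E - U)"
    unfolding positive_set_def
  proof (intro conjI ballI impI)
    show "E - U \<in> sets M" using U E by blast
    fix D assume "D \<in> sets M" "D \<subseteq> E - U"
    then show "0 \<le> Q D" using B(4)[of D] unfolding U_def by auto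
  qed
  ultimately show thesis using that[of "E - U"] by auto
qed

text \<open>Here the exhausting sequence consists of positive sets. A measurable set outside their union with a
  positive value would contain a positive set with a positive value, which the exhaustion rules out.\<close>
lemma Hahn_decomposition:
  assumes Q: "Q \<in> signed_measures M"
  obtains A where "positive_set M Q A" "\<forall>D\<in>sets M. D \<inter> A = {} \<longrightarrow> Q D \<le> 0"
proof -
  obtain B :: "nat \<Rightarrow> _" where B: "range B \<subseteq> {C. positive_set M Q C}" "disjoint_family B"
      "\<And>C. C \<in> {C. positive_set M Q C} \<Longrightarrow> C \<inter> (\<Union>n. B n) = {} \<Longrightarrow> Q C \<le> 0"
    by (rule greedy_exhaustion[OF Q, of "{C. positive_set M Q C}"])
      (auto simp: positive_set_def signed_measure_empty[OF Q])
  have meas: "B n \<in> sets M" for n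
    using B(1) by (auto simp: positive_set_def)
  have "positive_set M Q (\<Union>n. B n)"
    unfolding positive_set_def
  proof (intro conjI ballI impI)
    show "(\<Union>n. B n) \<in> sets M" using meas by blast
    fix D assume D: "D \<in> sets M" "D \<subseteq> (\<Union>n. B n)"
    have "disjoint_family (\<lambda>n. D \<inter> B n)"
      by (rule disjoint_family_on_bisimulation[OF B(2)]) auto
    then have "(\<lambda>n. Q (D \<inter> B n)) sums Q (\<Union>n. D \<inter> B n)"
      using D meas by (intro signed_measure_sums[OF Q]) auto
    moreover have "(\<Union>n. D \<inter> B n) = D" using D by blast
    moreover have "0 \<le> Q (D \<inter> B n)" for n
    proof -
      have "positive_set M Q (B n)" using B(1) by auto
      then show ?thesis unfolding positive_set_def using D(1) meas[of n] by auto
    qed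
    ultimately show "0 \<le> Q D"
      using sums_le[OF _ sums_zero] by metis
  qed
  moreover have "Q D \<le> 0" if D: "D \<in> sets M" "D \<inter> (\<Union>n. B n) = {}" for D
  proof -
    obtain C where C: "C \<subseteq> D" "positive_set M Q C" "Q D \<le> Q C"
      using positive_subset[OF Q D(1)] .
    then show ?thesis using B(3)[of C] D(2) by force
  qed
  ultimately show thesis using that by blast
qed

section \<open>Densities of absolutely continuous signed measures\<close>

definition is_density :: "'a measure \<Rightarrow> ('a set \<Rightarrow> real) \<Rightarrow> ('a \<Rightarrow> real) \<Rightarrow> bool" where
  "is_density P Q f \<longleftrightarrow> integrable P f \<and> (\<forall>A\<in>sets P. Q A = (LINT x:A|P. f x))"

lemma is_density_set_integrable:
  "is_density P Q f \<Longrightarrow> A \<in> sets P \<Longrightarrow> set_integrable P A f"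
  unfolding is_density_def set_integrable_def by (blast intro: integrable_mult_indicator)

text \<open>A nonnegative signed measure is a finite measure \<open>N\<close>, so that the Radon-Nikodym theorem for
  measures applies.\<close>
lemma (in finite_measure) nonneg_signed_measure_density:
  assumes Q: "Q \<in> ac_signed_measures M" and nn: "\<And>A. A \<in> sets M \<Longrightarrow> 0 \<le> Q A"
  obtains f where "is_density M Q f"
proof -
  have Q': "Q \<in> signed_measures M" and null: "\<And>A. A \<in> null_sets M \<Longrightarrow> Q A = 0"
    using Q by (auto simp: ac_signed_measures_def)
  define N where "N = measure_of (space M) (sets M) (\<lambda>A. ennreal (Q A))"
  have setsN[simp]: "sets N = sets M" by (simp add: N_def)
  have spN[simp]: "space N = space M" by (simp add: N_def)
  have emN: "emeasure N A = ennreal (Q A)" if "A \<in> sets M" for A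
    unfolding N_def
  proof (rule emeasure_measure_of_sigma[OF _ _ _ that])
    show "sigma_algebra (space M) (sets M)" by (rule sets.sigma_algebra_axioms)
    show "positive (sets M) (\<lambda>A. ennreal (Q A))"
      by (simp add: positive_def signed_measure_empty[OF Q'])
    show "countably_additive (sets M) (\<lambda>A. ennreal (Q A))"
    proof (rule countably_additiveI)
      fix A :: "nat \<Rightarrow> 'a set"
      assume A: "range A \<subseteq> sets M" "disjoint_family A" "(\<Union>i. A i) \<in> sets M"
      have "(\<lambda>n. ennreal (Q (A n))) sums ennreal (Q (\<Union>n. A n))"
        using A nn signed_measure_sums[OF Q' A(1,2)] by (subst sums_ennreal) auto
      then show "(\<Sum>i. ennreal (Q (A i))) = ennreal (Q (\<Union>i. A i))" by (rule sums_unique[symmetric])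
    qed
  qed
  interpret N: finite_measure N
    by (rule finite_measureI) (simp add: emN)
  have ac: "absolutely_continuous M N"
    unfolding absolutely_continuous_def using null emN by (auto simp: null_sets_def)
  define f where "f x = enn2real (RN_deriv M N x)" for x
  have [measurable]: "f \<in> borel_measurable M" unfolding f_def by measurable
  have dN: "density M (RN_deriv M N) = N"
    by (rule density_RN_deriv[OF ac]) simp
  have fin: "AE x in M. RN_deriv M N x = ennreal (f x)"
    using RN_deriv_finite[OF N.sigma_finite_measure_axioms ac setsN]
    by eventually_elim (auto simp: f_def ennreal_enn2real_if)
  have nnQ: "(\<integral>\<^sup>+x. ennreal (f x * indicator A x) \<partial>M) = ennreal (Q A)" if A: "A \<in> sets M" for A
  proof -
    have "ennreal (Q A) = (\<integral>\<^sup>+x. RN_deriv M N x * indicator A x \<partial>M)"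
      using A by (simp add: emN[symmetric] emeasure_density[symmetric] dN)
    also have "\<dots> = (\<integral>\<^sup>+x. ennreal (f x * indicator A x) \<partial>M)"
      by (rule nn_integral_cong_AE) (use fin in \<open>eventually_elim, auto split: split_indicator\<close>)
    finally show ?thesis ..
  qed
  have "integrable M f"
  proof (rule integrableI_nonneg)
    have "(\<integral>\<^sup>+x. ennreal (f x) \<partial>M) = (\<integral>\<^sup>+x. ennreal (f x * indicator (space M) x) \<partial>M)"
      by (rule nn_integral_cong) simp
    then show "(\<integral>\<^sup>+x. ennreal (f x) \<partial>M) < \<infinity>" using nnQ[of "space M"] by simp
  qed (auto simp: f_def)
  moreover have "Q A = (LINT x:A|M. f x)" if A: "A \<in> sets M" for A
    using nnQ[OF A] nn[OF A] A unfolding set_lebesgue_integral_def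
    by (subst integral_eq_nn_integral) (auto simp: f_def mult.commute)
  ultimately show thesis using that unfolding is_density_def by blast
qed

text \<open>The value 0 off \<open>sets M\<close> is the dummy value that \<open>signed_measures\<close> prescribes.\<close>
lemma restricted_ac_signed_measure:
  assumes Q: "Q \<in> ac_signed_measures M" and A: "A \<in> sets M"
  shows "(\<lambda>E. if E \<in> sets M then Q (E \<inter> A) else 0) \<in> ac_signed_measures M" (is "?R \<in> _")
proof -
  have Q': "Q \<in> signed_measures M" and null: "\<And>A. A \<in> null_sets M \<Longrightarrow> Q A = 0"
    using Q by (auto simp: ac_signed_measures_def)
  have "(\<lambda>n. ?R (B n)) sums ?R (\<Union>n. B n)" if B: "range B \<subseteq> sets M" "disjoint_family B" for B :: "nat \<Rightarrow> _"
  proof -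
    have "(\<lambda>n. Q (B n \<inter> A)) sums Q (\<Union>n. B n \<inter> A)"
      using B A by (intro signed_measure_sums[OF Q']) (auto simp: disjoint_family_on_def)
    moreover have "(\<Union>n. B n) \<in> sets M" "\<And>n. B n \<in> sets M" using B(1) by auto
    ultimately show ?thesis by simp
  qed
  moreover have "?R E = 0" if "E \<in> null_sets M" for E
    using null_set_Int2[OF that A] null by (auto simp: Int_commute)
  ultimately show ?thesis
    unfolding ac_signed_measures_def signed_measures_def by (auto simp: signed_measure_empty[OF Q'])
qed

text \<open>The Hahn decomposition writes \<open>Q\<close> as the difference of two nonnegative signed measures, each of
  which has a density. Hence the choice in the definition of \<open>signed_RN_deriv\<close> has a witness.\<close>
proposition (in finite_measure) signed_RN_deriv_is_density:
  assumes Q: "Q \<in> ac_signed_measures M"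
  shows "is_density M Q (signed_RN_deriv M Q)"
proof -
  have Q': "Q \<in> signed_measures M" using Q by (simp add: ac_signed_measures_def)
  obtain A where A: "positive_set M Q A" "\<forall>D\<in>sets M. D \<inter> A = {} \<longrightarrow> Q D \<le> 0"
    using Hahn_decomposition[OF Q'] .
  have AM: "A \<in> sets M" and posA: "\<And>D. D \<in> sets M \<Longrightarrow> D \<subseteq> A \<Longrightarrow> 0 \<le> Q D"
    using A(1) by (auto simp: positive_set_def)
  let ?R = "\<lambda>C E. if E \<in> sets M then Q (E \<inter> C) else 0"
  have 1: "?R A \<in> ac_signed_measures M"
    by (rule restricted_ac_signed_measure[OF Q AM])
  have "?R (space M - A) \<in> ac_signed_measures M"
    using AM by (intro restricted_ac_signed_measure[OF Q]) auto
  then have 2: "(\<lambda>E. - ?R (space M - A) E) \<in> ac_signed_measures M"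
    using uminus_signed_measure unfolding ac_signed_measures_def by fastforce
  obtain f where f: "is_density M (?R A) f"
    using nonneg_signed_measure_density[OF 1] posA AM by auto
  have "0 \<le> - ?R (space M - A) E" if "E \<in> sets M" for E
    using A(2)[rule_format, of "E \<inter> (space M - A)"] that AM by auto
  then obtain h where h: "is_density M (\<lambda>E. - ?R (space M - A) E) h"
    using nonneg_signed_measure_density[OF 2] by blast
  have "is_density M Q (\<lambda>x. f x - h x)"
    unfolding is_density_def
  proof (intro conjI ballI)
    show "integrable M (\<lambda>x. f x - h x)" using f h by (auto simp: is_density_def)
    fix E assume E: "E \<in> sets M"
    have "E \<inter> A \<union> E \<inter> (space M - A) = E" using sets.sets_into_space[OF E] by blast
    then have "Q E = Q (E \<inter> A) + Q (E \<inter> (space M - A))"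
      using signed_measure_Un[OF Q', of "E \<inter> A" "E \<inter> (space M - A)"] AM E by auto
    also have "Q (E \<inter> A) = (LINT x:E|M. f x)"
      using f E by (simp add: is_density_def)
    also have "- Q (E \<inter> (space M - A)) = (LINT x:E|M. h x)"
      using h E by (simp add: is_density_def)
    then have "Q (E \<inter> (space M - A)) = - (LINT x:E|M. h x)" by simp
    also have "(LINT x:E|M. f x) + - (LINT x:E|M. h x) = (LINT x:E|M. f x - h x)"
      using f h E by (subst set_integral_diff) (auto intro: is_density_set_integrable)
    finally show "Q E = (LINT x:E|M. f x - h x)" .
  qed
  then show ?thesis
    unfolding signed_RN_deriv_def is_density_def
    by (rule someI[where P = "\<lambda>f. integrable M f \<and> (\<forall>A\<in>sets M. Q A = (LINT x:A|M. f x))"])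
qed

lemma (in finite_measure) AE_signed_RN_deriv_unique:
  assumes "Q \<in> ac_signed_measures M" "is_density M Q f"
  shows "AE x in M. signed_RN_deriv M Q x = f x"
  using signed_RN_deriv_is_density[OF assms(1)] assms(2) unfolding is_density_def
  by (intro density_unique_real) auto

text \<open>The convex combination of the densities is a density of the convex combination, and densities are
  unique up to a null set.\<close>
lemma (in finite_measure) AE_signed_RN_deriv_convex:
  assumes Q1: "Q1 \<in> ac_signed_measures M" and Q2: "Q2 \<in> ac_signed_measures M"
    and Q: "(\<lambda>A. (1 - t) * Q1 A + t * Q2 A) \<in> signed_measures M" (is "?Q \<in> _")
  shows "?Q \<in> ac_signed_measures M"
    "AE x in M. signed_RN_deriv M ?Q x = (1 - t) * signed_RN_deriv M Q1 x + t * signed_RN_deriv M Q2 x"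
proof -
  show ac: "?Q \<in> ac_signed_measures M"
    using assms unfolding ac_signed_measures_def by auto
  have d: "is_density M Q1 (signed_RN_deriv M Q1)" "is_density M Q2 (signed_RN_deriv M Q2)"
    using Q1 Q2 by (auto intro: signed_RN_deriv_is_density)
  have "is_density M ?Q (\<lambda>x. (1 - t) * signed_RN_deriv M Q1 x + t * signed_RN_deriv M Q2 x)"
    unfolding is_density_def
  proof (intro conjI ballI)
    fix A assume A: "A \<in> sets M"
    have si: "set_integrable M A (signed_RN_deriv M Q1)" "set_integrable M A (signed_RN_deriv M Q2)"
      using d A by (auto intro: is_density_set_integrable)
    show "?Q A = (LINT x:A|M. (1 - t) * signed_RN_deriv M Q1 x + t * signed_RN_deriv M Q2 x)"
      using d A si by (subst set_integral_add) (auto simp: is_density_def)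
  qed (use d in \<open>auto simp: is_density_def\<close>)
  then show "AE x in M. signed_RN_deriv M ?Q x = (1 - t) * signed_RN_deriv M Q1 x + t * signed_RN_deriv M Q2 x"
    by (rule AE_signed_RN_deriv_unique[OF ac])
qed

section \<open>Tangents and difference quotients of the divergence function\<close>

locale smooth_divergence =
  fixes \<phi> :: "real \<Rightarrow> ennreal"
  assumes divergence: "divergence_function \<phi>"
    and differentiable: "differentiable_divergence \<phi>"
begin

abbreviation "dom\<phi> \<equiv> eff_domain \<phi>"
abbreviation "int\<phi> \<equiv> einterval (lower_end \<phi>) (upper_end \<phi>)"
abbreviation "f \<equiv> (\<lambda>x. enn2real (\<phi> x))"
abbreviation "d \<equiv> deriv f"

lemma phi_eq: "x \<in> dom\<phi> \<Longrightarrow> \<phi> x = ennreal (f x)"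
  by (simp add: eff_domain_def)

lemma domain_bounds:
  assumes "x \<in> dom\<phi>"
  shows "lower_end \<phi> \<le> ereal x" "ereal x \<le> upper_end \<phi>"
  unfolding lower_end_def upper_end_def using assms by (auto intro: INF_lower SUP_upper)

lemma interior_subset: "int\<phi> \<subseteq> dom\<phi>"
proof
  fix x assume "x \<in> int\<phi>"
  then have "lower_end \<phi> < ereal x" "ereal x < upper_end \<phi>" by (auto simp: einterval_iff)
  then obtain u v where "u \<in> dom\<phi>" "v \<in> dom\<phi>" "u < x" "x < v"
    unfolding lower_end_def upper_end_def INF_less_iff less_SUP_iff by auto
  moreover have "is_interval dom\<phi>" using divergence by (simp add: divergence_function_def)
  ultimately show "x \<in> dom\<phi>"
    using mem_is_interval_1_I[of "dom\<phi>" u v x] by auto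
qed

lemma domain_cases:
  assumes "x \<in> dom\<phi>"
  obtains "x \<in> int\<phi>" | "ereal x = lower_end \<phi>" | "ereal x = upper_end \<phi>"
  using domain_bounds[OF assms] by (force simp: einterval_iff)

lemma phi_deriv_interior: "x \<in> int\<phi> \<Longrightarrow> phi_deriv \<phi> x = ereal (d x)"
  by (simp add: phi_deriv_def einterval_iff)

lemma phi_convex:
  assumes "t \<in> {0..1}"
  shows "\<phi> ((1 - t) * x + t * y) \<le> ennreal (1 - t) * \<phi> x + ennreal t * \<phi> y"
  using divergence assms unfolding divergence_function_def convex_ext_def by blast

lemma convex_on_domain: "convex_on dom\<phi> f"
proof (rule convex_onI)
  show "convex dom\<phi>"
    using divergence by (simp add: divergence_function_def is_interval_convex_1)
  fix t x y :: real
  assume t: "0 < t" "t < 1" and x: "x \<in> dom\<phi>" and y: "y \<in> dom\<phi>"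
  have "\<phi> ((1 - t) * x + t * y) \<le> ennreal (1 - t) * ennreal (f x) + ennreal t * ennreal (f y)"
    using phi_convex[of t x y] t x y by (simp flip: phi_eq)
  also have "\<dots> = ennreal ((1 - t) * f x + t * f y)"
    using t by (simp flip: ennreal_mult ennreal_plus)
  finally show "f ((1 - t) *\<^sub>R x + t *\<^sub>R y) \<le> (1 - t) * f x + t * f y"
    using t by (auto intro!: enn2real_leI)
qed

lemma domain_convex:
  assumes "x \<in> dom\<phi>" "y \<in> dom\<phi>" "0 \<le> t" "t \<le> 1"
  shows "(1 - t) * x + t * y \<in> dom\<phi>"
    and "f ((1 - t) * x + t * y) \<le> (1 - t) * f x + t * f y"
  using convexD_alt[OF convex_on_imp_convex[OF convex_on_domain] assms]
    convex_onD[OF convex_on_domain, of t x y] assms by auto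

lemma has_deriv: "x \<in> int\<phi> \<Longrightarrow> (f has_real_derivative d x) (at x)"
  using differentiable unfolding differentiable_divergence_def
  by (metis DERIV_deriv_iff_real_differentiable at_within_open differentiable_on_def open_einterval)

lemma tangent_interior:
  assumes x: "x \<in> int\<phi>" and y: "y \<in> dom\<phi>"
  shows "f x + d x * (y - x) \<le> f y"
proof -
  have "x \<in> interior dom\<phi>"
    using x interior_subset interior_maximal open_einterval by blast
  moreover have "connected dom\<phi>"
    using divergence by (simp add: divergence_function_def is_interval_connected_1)
  moreover have "(f has_real_derivative d x) (at x within dom\<phi>)"
    by (rule has_field_derivative_at_within[OF has_deriv[OF x]])
  ultimately show ?thesis
    using convex_on_imp_above_tangent[OF convex_on_domain _ _ y, of x "d x"] by simp
qed

lemma deriv_mono: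
  assumes "x \<in> int\<phi>" "y \<in> int\<phi>" "x \<le> y"
  shows "d x \<le> d y"
proof (cases "x = y")
  case False
  have "f x + d x * (y - x) \<le> f y" "f y + d y * (x - y) \<le> f x"
    using assms interior_subset by (auto intro!: tangent_interior)
  then have "d x * (y - x) \<le> d y * (y - x)" by (simp add: algebra_simps)
  then show ?thesis using False assms by simp
qed simp

lemma lower_less_upper: "lower_end \<phi> < upper_end \<phi>"
  using divergence less_trans unfolding divergence_function_def by blast

text \<open>Because the derivative is increasing, its one-sided limit at an endpoint exists and is its
  infimum (or, at the upper endpoint, its supremum). Hence the \<open>Lim\<close> in the definition of
  \<open>phi_deriv\<close> is a genuine limit.\<close>
lemma at_lower_end:
  assumes a: "ereal a = lower_end \<phi>"
  shows "eventually (\<lambda>y. y \<in> int\<phi>) (at_right a)"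
    and "((\<lambda>y. ereal (d y)) \<longlongrightarrow> phi_deriv \<phi> a) (at_right a)"
    and "\<And>y. y \<in> int\<phi> \<Longrightarrow> phi_deriv \<phi> a \<le> ereal (d y)"
proof -
  obtain c where c: "c \<in> int\<phi>"
    using einterval_nonempty[OF lower_less_upper] by blast
  have below: "y \<in> int\<phi>" if "a < y" "y < z" "z \<in> int\<phi>" for y z
    using that by (auto simp: einterval_iff a[symmetric] intro: less_trans[of "ereal y" "ereal z"])
  have gt: "a < z" if "z \<in> int\<phi>" for z
    using that a by (metis einterval_iff less_ereal.simps(1))
  have ev: "eventually (\<lambda>y. a < y \<and> y < z) (at_right a)" if "z \<in> int\<phi>" for z
    using gt[OF that] by (auto simp: eventually_at_right_field)
  show evI: "eventually (\<lambda>y. y \<in> int\<phi>) (at_right a)"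
    using ev[OF c] by eventually_elim (use below c in blast)
  let ?L = "INF y\<in>int\<phi>. ereal (d y)"
  have lim: "((\<lambda>y. ereal (d y)) \<longlongrightarrow> ?L) (at_right a)"
  proof (rule order_tendstoI)
    fix l assume "l < ?L"
    then show "eventually (\<lambda>y. l < ereal (d y)) (at_right a)"
      using evI by (auto elim!: eventually_mono intro: less_le_trans INF_lower)
  next
    fix u assume "?L < u"
    then obtain z where z: "z \<in> int\<phi>" "ereal (d z) < u" by (auto simp: INF_less_iff)
    show "eventually (\<lambda>y. ereal (d y) < u) (at_right a)"
      using ev[OF z(1)]
    proof eventually_elim
      case (elim y)
      then have "d y \<le> d z" using below[of y z] z deriv_mono[of y z] by auto
      then show ?case using z(2) by (metis ereal_less_eq(3) le_less_trans)
    qed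
  qed
  have "phi_deriv \<phi> a = ?L"
    using tendsto_Lim[OF _ lim] a by (simp add: phi_deriv_def)
  then show "((\<lambda>y. ereal (d y)) \<longlongrightarrow> phi_deriv \<phi> a) (at_right a)"
    and "\<And>y. y \<in> int\<phi> \<Longrightarrow> phi_deriv \<phi> a \<le> ereal (d y)"
    using lim by (auto intro: INF_lower)
qed

lemma at_upper_end:
  assumes b: "ereal b = upper_end \<phi>"
  shows "eventually (\<lambda>y. y \<in> int\<phi>) (at_left b)"
    and "((\<lambda>y. ereal (d y)) \<longlongrightarrow> phi_deriv \<phi> b) (at_left b)"
proof -
  obtain c where c: "c \<in> int\<phi>"
    using einterval_nonempty[OF lower_less_upper] by blast
  have above: "y \<in> int\<phi>" if "z < y" "y < b" "z \<in> int\<phi>" for y z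
    using that by (auto simp: einterval_iff b[symmetric] intro: less_trans[of _ "ereal z" "ereal y"])
  have gt: "z < b" if "z \<in> int\<phi>" for z
    using that b by (metis einterval_iff less_ereal.simps(1))
  have ev: "eventually (\<lambda>y. z < y \<and> y < b) (at_left b)" if "z \<in> int\<phi>" for z
    using gt[OF that] by (auto simp: eventually_at_left_field)
  show evI: "eventually (\<lambda>y. y \<in> int\<phi>) (at_left b)"
    using ev[OF c] by eventually_elim (use above c in blast)
  let ?L = "SUP y\<in>int\<phi>. ereal (d y)"
  have lim: "((\<lambda>y. ereal (d y)) \<longlongrightarrow> ?L) (at_left b)"
  proof (rule order_tendstoI)
    fix u assume "?L < u"
    then show "eventually (\<lambda>y. ereal (d y) < u) (at_left b)"
      using evI by (auto elim!: eventually_mono intro: le_less_trans[rotated] SUP_upper)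
  next
    fix l assume "l < ?L"
    then obtain z where z: "z \<in> int\<phi>" "l < ereal (d z)" by (auto simp: less_SUP_iff)
    show "eventually (\<lambda>y. l < ereal (d y)) (at_left b)"
      using ev[OF z(1)]
    proof eventually_elim
      case (elim y)
      then have "d z \<le> d y" using above[of z y] z deriv_mono[of z y] by auto
      then show ?case using z(2) by (metis ereal_less_eq(3) less_le_trans)
    qed
  qed
  have "phi_deriv \<phi> b = ?L"
    using tendsto_Lim[OF _ lim] b less_imp_neq[OF lower_less_upper] by (simp add: phi_deriv_def)
  then show "((\<lambda>y. ereal (d y)) \<longlongrightarrow> phi_deriv \<phi> b) (at_left b)"
    using lim by simp
qed

lemma phi_deriv_infinite_at_end:
  assumes "x \<in> dom\<phi>" "\<bar>phi_deriv \<phi> x\<bar> = \<infinity>"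
  shows "ereal x = lower_end \<phi> \<or> ereal x = upper_end \<phi>"
  using assms by (cases rule: domain_cases) (auto simp: phi_deriv_interior)

lemma phi_deriv_lower_end_less_infinity:
  assumes "ereal a = lower_end \<phi>"
  shows "phi_deriv \<phi> a \<noteq> \<infinity>"
  using at_lower_end(3)[OF assms] einterval_nonempty[OF lower_less_upper] by force

text \<open>The tangent inequality passes to an endpoint by letting the point of tangency tend to it. This is
  the place where closedness of \<open>\<phi>\<close> enters.\<close>
lemma tangent_limit:
  assumes F: "F \<noteq> bot" "((\<lambda>z. z) \<longlongrightarrow> x) F" "eventually (\<lambda>z. z \<in> int\<phi>) F"
    and phi: "(\<phi> \<longlongrightarrow> \<phi> x) F" and slope: "((\<lambda>z. ereal (d z)) \<longlongrightarrow> ereal r) F"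
    and x: "x \<in> dom\<phi>" and y: "y \<in> dom\<phi>"
  shows "f x + r * (y - x) \<le> f y"
proof -
  have "(f \<longlongrightarrow> f x) F"
    using phi phi_eq[OF x] by (intro tendsto_enn2real) auto
  moreover have "(d \<longlongrightarrow> r) F" using slope by simp
  ultimately have "((\<lambda>z. f z + d z * (y - z)) \<longlongrightarrow> f x + r * (y - x)) F"
    using F(2) by (intro tendsto_add tendsto_mult tendsto_diff tendsto_const)
  moreover have "eventually (\<lambda>z. f z + d z * (y - z) \<le> f y) F"
    using F(3) by eventually_elim (rule tangent_interior[OF _ y])
  ultimately show ?thesis using F(1) tendsto_upperbound by blast
qed

lemma tangent:
  assumes x: "x \<in> dom\<phi>" and y: "y \<in> dom\<phi>" and fin: "\<bar>phi_deriv \<phi> x\<bar> \<noteq> \<infinity>"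
  shows "f x + real_of_ereal (phi_deriv \<phi> x) * (y - x) \<le> f y"
proof -
  have closed: "closed_ext \<phi>" using divergence by (simp add: divergence_function_def)
  have r: "phi_deriv \<phi> x = ereal (real_of_ereal (phi_deriv \<phi> x))" using fin by (simp add: ereal_real')
  from x show ?thesis
  proof (cases rule: domain_cases)
    case 1
    then show ?thesis using tangent_interior[OF 1 y] by (simp add: phi_deriv_interior)
  next
    case 2
    then have "(\<phi> \<longlongrightarrow> \<phi> x) (at_right x)" using closed by (simp add: closed_ext_def)
    then show ?thesis
      using at_lower_end[OF 2] r x y by (intro tangent_limit[of "at_right x"]) auto
  next
    case 3
    then have "(\<phi> \<longlongrightarrow> \<phi> x) (at_left x)" using closed by (simp add: closed_ext_def)
    then show ?thesis
      using at_upper_end[OF 3] r x y by (intro tangent_limit[of "at_left x"]) auto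
  qed
qed

text \<open>In the interior this is differentiability at \<open>x\<close>. At the lower endpoint the quotient lies between
  two bounds with the same limit: the tangent at \<open>x\<close> bounds it from below (trivially if the slope is
  \<open>- \<infinity>\<close>), and the tangent at the intermediate point, whose slope tends to \<open>phi_deriv \<phi> x\<close>, bounds
  it from above.\<close>
lemma difference_quotient_limit:
  assumes x: "x \<in> dom\<phi>" and y: "y \<in> dom\<phi>" and ub: "ereal x \<noteq> upper_end \<phi>"
    and t: "t \<longlonglongrightarrow> 0" "\<And>n. 0 < t n" "\<And>n. t n < 1"
  shows "(\<lambda>n. ereal ((f ((1 - t n) * x + t n * y) - f x) / t n)) \<longlonglongrightarrow> phi_deriv \<phi> x * ereal (y - x)"
proof (cases "y = x")
  case True
  then show ?thesis by (simp add: algebra_simps zero_ereal_def[symmetric])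
next
  case False
  have z_eq: "(1 - t n) * x + t n * y = x + t n * (y - x)" for n by (simp add: algebra_simps)
  have z_lim: "(\<lambda>n. x + t n * (y - x)) \<longlonglongrightarrow> x + 0 * (y - x)"
    by (intro tendsto_intros t)
  from x show ?thesis
  proof (cases rule: domain_cases)
    case 1
    have "(\<lambda>n. t n * (y - x)) \<longlonglongrightarrow> 0 * (y - x)" by (intro tendsto_intros t)
    then have "filterlim (\<lambda>n. t n * (y - x)) (at 0) sequentially"
      using False t(2) by (auto simp: filterlim_at less_imp_neq[symmetric])
    with has_deriv[OF 1] have
      "(\<lambda>n. (f (x + t n * (y - x)) - f x) / (t n * (y - x)) * (y - x)) \<longlonglongrightarrow> d x * (y - x)"
      unfolding DERIV_def by (intro tendsto_mult tendsto_const) (rule filterlim_compose)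
    then show ?thesis
      using False by (simp add: phi_deriv_interior[OF 1] z_eq)
  next
    case 2
    have xy: "x < y" using domain_bounds(1)[OF y] False by (simp flip: 2)
    define z where "z n = x + t n * (y - x)" for n
    have z: "x < z n" "z n < y" for n
    proof -
      show "x < z n" using xy t(2)[of n] by (simp add: z_def)
      have "t n * (y - x) < 1 * (y - x)" using xy t(3)[of n] by (intro mult_strict_right_mono) auto
      then show "z n < y" by (simp add: z_def)
    qed
    have zI: "z n \<in> int\<phi>" for n
      using z[of n] domain_bounds(2)[OF y]
      by (auto simp: einterval_iff 2[symmetric] intro: less_le_trans[of _ "ereal y"])
    have "filterlim z (at_right x) sequentially"
      using z_lim z(1) by (intro tendsto_imp_filterlim_at_right) (auto simp flip: z_def)
    then have "(\<lambda>n. ereal (d (z n))) \<longlonglongrightarrow> phi_deriv \<phi> x"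
      by (rule filterlim_compose[OF at_lower_end(2)[OF 2]])
    then have up: "(\<lambda>n. ereal (d (z n)) * ereal (y - x)) \<longlonglongrightarrow> phi_deriv \<phi> x * ereal (y - x)"
      by (subst (1 2) mult.commute) (intro tendsto_cmult_ereal, auto)
    have le_up: "(f (z n) - f x) / t n \<le> d (z n) * (y - x)" for n
    proof -
      have "f (z n) + d (z n) * (x - z n) \<le> f x" by (rule tangent_interior[OF zI x])
      then have "f (z n) - f x \<le> d (z n) * (y - x) * t n" by (simp add: z_def algebra_simps)
      then show ?thesis using t(2)[of n] by (simp add: divide_le_eq)
    qed
    have ge: "phi_deriv \<phi> x * ereal (y - x) \<le> ereal ((f (z n) - f x) / t n)" for n
    proof (cases "phi_deriv \<phi> x")
      case (real r)
      have "f x + r * (z n - x) \<le> f (z n)"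
        using tangent[OF x, of "z n"] zI[of n] interior_subset real by auto
      then have "r * (y - x) * t n \<le> f (z n) - f x" by (simp add: z_def algebra_simps)
      then show ?thesis using t(2)[of n] real by (simp add: le_divide_eq)
    next
      case PInf
      then show ?thesis using phi_deriv_lower_end_less_infinity[OF 2] by simp
    next
      case MInf
      then show ?thesis using xy by simp
    qed
    have "(\<lambda>n. ereal ((f (z n) - f x) / t n)) \<longlonglongrightarrow> phi_deriv \<phi> x * ereal (y - x)"
      by (rule tendsto_sandwich[OF _ _ tendsto_const up]) (use ge le_up in auto)
    then show ?thesis by (simp add: z_eq z_def)
  next
    case 3
    then show ?thesis using ub by simp
  qed
qed

text \<open>The sublevel sets are convex, hence intervals.\<close>
lemma measurable_phi[measurable]: "\<phi> \<in> borel_measurable borel"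
proof (rule borel_measurableI_le)
  fix c
  have "convex {x. \<phi> x \<le> c}"
    unfolding convex_alt
  proof (intro ballI allI impI)
    fix x y u :: real assume xy: "x \<in> {x. \<phi> x \<le> c}" "y \<in> {x. \<phi> x \<le> c}" and u: "0 \<le> u \<and> u \<le> 1"
    have "\<phi> ((1 - u) * x + u * y) \<le> ennreal (1 - u) * \<phi> x + ennreal u * \<phi> y"
      using phi_convex u by auto
    also have "\<dots> \<le> ennreal (1 - u) * c + ennreal u * c"
      using xy by (intro add_mono mult_left_mono) auto
    also have "\<dots> = c"
      using u by (simp flip: distrib_right ennreal_plus)
    finally show "(1 - u) *\<^sub>R x + u *\<^sub>R y \<in> {x. \<phi> x \<le> c}" by simp
  qed
  then show "{x \<in> space borel. \<phi> x \<le> c} \<in> sets borel"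
    by (auto intro: real_interval_borel_measurable simp: is_interval_convex_1)
qed

text \<open>Apart from at most two points, this is a monotone function on an open interval, extended by 0.\<close>
lemma measurable_phi_deriv[measurable]: "phi_deriv \<phi> \<in> borel_measurable borel"
proof -
  define a where "a = real_of_ereal (lower_end \<phi>)"
  define b where "b = real_of_ereal (upper_end \<phi>)"
  have "mono_on int\<phi> d" by (rule mono_onI) (rule deriv_mono)
  then have "d \<in> borel_measurable (restrict_space borel int\<phi>)"
    by (rule borel_measurable_mono_on_fnc)
  then have [measurable]: "(\<lambda>x. d x * indicator int\<phi> x) \<in> borel_measurable borel"
    by (subst (asm) borel_measurable_restrict_space_iff) (auto simp: mult.commute)
  have "phi_deriv \<phi> x = (if x \<in> int\<phi> then ereal (d x * indicator int\<phi> x) else if x = a then phi_deriv \<phi> a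
      else if x = b then phi_deriv \<phi> b else 0)" for x
  proof -
    consider "x \<in> int\<phi>" | "x = a" | "x = b" | "x \<notin> int\<phi>" "x \<noteq> a" "x \<noteq> b" by blast
    then show ?thesis
    proof cases
      case 4
      then have "ereal x \<noteq> lower_end \<phi>" "ereal x \<noteq> upper_end \<phi>"
        unfolding a_def b_def by (metis real_of_ereal.simps(1))+
      then show ?thesis using 4 by (auto simp: phi_deriv_def einterval_iff)
    qed (auto simp: phi_deriv_interior)
  qed
  then have "phi_deriv \<phi> = (\<lambda>x. if x \<in> int\<phi> then ereal (d x * indicator int\<phi> x) else if x = a then phi_deriv \<phi> a
      else if x = b then phi_deriv \<phi> b else 0)" by blast
  moreover have "\<dots> \<in> borel_measurable borel" by measurable
  ultimately show ?thesis by simp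
qed

end

section \<open>Integrals of extended real functions\<close>

lemma ext_integral_AE_real:
  assumes u: "integrable P u" and eq: "AE x in P. h x = ereal (u x)"
  shows "ext_integral P h = ereal (\<integral>x. u x \<partial>P)"
proof -
  have "(\<integral>\<^sup>+x. e2ennreal (h x) \<partial>P) = (\<integral>\<^sup>+x. ennreal (u x) \<partial>P)"
    "(\<integral>\<^sup>+x. e2ennreal (- h x) \<partial>P) = (\<integral>\<^sup>+x. ennreal (- u x) \<partial>P)"
    by (rule nn_integral_cong_AE, use eq in \<open>eventually_elim, simp\<close>)+
  moreover have "(\<integral>\<^sup>+x. ennreal (u x) \<partial>P) < \<infinity>" "(\<integral>\<^sup>+x. ennreal (- u x) \<partial>P) < \<infinity>"
    using u unfolding real_integrable_def by (auto simp: less_top)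
  ultimately show ?thesis
    unfolding ext_integral_def real_lebesgue_integral_def[OF u]
    by (auto simp: less_top_ennreal enn2ereal_ennreal)
qed

lemma ext_L1_AE_real:
  assumes u: "integrable P u" and h: "h \<in> borel_measurable P" and eq: "AE x in P. h x = ereal (u x)"
  shows "ext_L1 P h"
proof -
  have "(\<integral>\<^sup>+x. e2ennreal \<bar>h x\<bar> \<partial>P) = (\<integral>\<^sup>+x. ennreal (norm (u x)) \<partial>P)"
    by (rule nn_integral_cong_AE, use eq in \<open>eventually_elim, simp\<close>)
  then show ?thesis
    using u h unfolding ext_L1_def integrable_iff_bounded by simp
qed

lemma ext_L1_finite:
  assumes h: "ext_L1 P h"
  shows "AE x in P. \<bar>h x\<bar> \<noteq> \<infinity>" and "integrable P (\<lambda>x. real_of_ereal (h x))"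
    and "ext_integral P h = ereal (\<integral>x. real_of_ereal (h x) \<partial>P)"
proof -
  have [measurable]: "h \<in> borel_measurable P" and fin: "(\<integral>\<^sup>+x. e2ennreal \<bar>h x\<bar> \<partial>P) < \<infinity>"
    using h by (auto simp: ext_L1_def)
  have "AE x in P. e2ennreal \<bar>h x\<bar> \<noteq> \<infinity>"
    by (rule nn_integral_PInf_AE) (use fin in auto)
  then show ae: "AE x in P. \<bar>h x\<bar> \<noteq> \<infinity>"
    by eventually_elim auto
  have "(\<integral>\<^sup>+x. ennreal (norm (real_of_ereal (h x))) \<partial>P) = (\<integral>\<^sup>+x. e2ennreal \<bar>h x\<bar> \<partial>P)"
  proof (rule nn_integral_cong_AE, use ae in eventually_elim)
    case (elim x)
    then show ?case by (cases "h x") auto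
  qed
  then show int: "integrable P (\<lambda>x. real_of_ereal (h x))"
    using fin by (intro integrableI_bounded) auto
  show "ext_integral P h = ereal (\<integral>x. real_of_ereal (h x) \<partial>P)"
    by (rule ext_integral_AE_real[OF int]) (use ae in \<open>eventually_elim, simp add: ereal_real'\<close>)
qed

section \<open>Sufficiency\<close>

locale smooth_divergence_space = smooth_divergence \<phi> + prob_space P
  for \<phi> :: "real \<Rightarrow> ennreal" and P :: "'a measure"
begin

abbreviation "dens \<equiv> signed_RN_deriv P"

lemma phi_dom_density:
  assumes Q: "Q \<in> phi_dom \<phi> P"
  shows "Q \<in> ac_signed_measures P" "integrable P (dens Q)" "AE x in P. dens Q x \<in> dom\<phi>"
    "integrable P (\<lambda>x. f (dens Q x))"
    "phi_divergence \<phi> P Q = ennreal (\<integral>x. f (dens Q x) \<partial>P)"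
proof -
  have fin: "phi_divergence \<phi> P Q < \<infinity>" using Q by (simp add: phi_dom_def)
  then show ac: "Q \<in> ac_signed_measures P" by (auto simp: phi_divergence_def split: if_splits)
  show i: "integrable P (dens Q)"
    using signed_RN_deriv_is_density[OF ac] by (simp add: is_density_def)
  then have [measurable]: "dens Q \<in> borel_measurable P" by auto
  have nn: "phi_divergence \<phi> P Q = (\<integral>\<^sup>+x. \<phi> (dens Q x) \<partial>P)"
    using ac by (simp add: phi_divergence_def)
  have "AE x in P. \<phi> (dens Q x) \<noteq> \<infinity>"
    by (rule nn_integral_PInf_AE) (use fin nn in auto)
  then show ae: "AE x in P. dens Q x \<in> dom\<phi>"
    by eventually_elim (simp add: eff_domain_def less_top)
  have nn': "phi_divergence \<phi> P Q = (\<integral>\<^sup>+x. ennreal (f (dens Q x)) \<partial>P)"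
    unfolding nn by (rule nn_integral_cong_AE, use ae in eventually_elim) (rule phi_eq)
  show "integrable P (\<lambda>x. f (dens Q x))"
    using fin unfolding nn' by (intro integrableI_nonneg) auto
  then show "phi_divergence \<phi> P Q = ennreal (\<integral>x. f (dens Q x) \<partial>P)"
    unfolding nn' by (intro nn_integral_eq_integral) auto
qed

text \<open>The tangent inequality in a form that makes sense for infinite slopes: two products with an infinite
  slope can only be finite if both factors \<open>x\<close> and \<open>y\<close> vanish, and then there is nothing to prove.\<close>
lemma tangent_products:
  assumes x: "x \<in> dom\<phi>" and y: "y \<in> dom\<phi>"
    and fx: "\<bar>phi_deriv \<phi> x * ereal x\<bar> \<noteq> \<infinity>" and fy: "\<bar>phi_deriv \<phi> x * ereal y\<bar> \<noteq> \<infinity>"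
  shows "f x + (real_of_ereal (phi_deriv \<phi> x * ereal y) - real_of_ereal (phi_deriv \<phi> x * ereal x)) \<le> f y"
proof (cases "\<bar>phi_deriv \<phi> x\<bar> = \<infinity>")
  case True
  then have "x = 0" "y = 0"
    using fx fy by (cases "phi_deriv \<phi> x"; auto split: if_splits)+
  then show ?thesis by simp
next
  case False
  then show ?thesis
    using tangent[OF x y] by (cases "phi_deriv \<phi> x") (auto simp: algebra_simps)
qed

lemma sufficient_for_projection:
  assumes \<Omega>: "\<Omega> \<subseteq> signed_measures P" and S: "S \<in> \<Omega> \<inter> phi_dom \<phi> P"
    and i: "\<And>Q. Q \<in> \<Omega> \<inter> phi_dom \<phi> P \<Longrightarrow> ext_L1 P (\<lambda>x. phi_deriv \<phi> (dens S x) * ereal (dens Q x))"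
    and ii: "\<And>Q. Q \<in> \<Omega> \<inter> phi_dom \<phi> P \<Longrightarrow>
      signed_integral P S (\<lambda>x. phi_deriv \<phi> (dens S x)) \<le> signed_integral P Q (\<lambda>x. phi_deriv \<phi> (dens S x))"
  shows "is_phi_projection \<phi> P \<Omega> S"
  unfolding is_phi_projection_def
proof (intro conjI ballI)
  show "S \<in> \<Omega>" using S by simp
  show "(INF Q\<in>\<Omega>. phi_divergence \<phi> P Q) < \<infinity>"
    using S by (auto simp: INF_less_iff phi_dom_def)
  fix Q assume Q: "Q \<in> \<Omega>"
  show "phi_divergence \<phi> P S \<le> phi_divergence \<phi> P Q"
  proof (cases "Q \<in> phi_dom \<phi> P")
    case False
    then have "phi_divergence \<phi> P Q = \<infinity>" using Q \<Omega> unfolding phi_dom_def by (auto simp: less_top[symmetric])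
    then show ?thesis by simp
  next
    case True
    define p where "p R x = real_of_ereal (phi_deriv \<phi> (dens S x) * ereal (dens R x))" for R x
    note L1S = ext_L1_finite[OF i[OF S], folded p_def]
    have S': "S \<in> phi_dom \<phi> P" using S by simp
    have Q': "Q \<in> \<Omega> \<inter> phi_dom \<phi> P" using Q True by simp
    note L1Q = ext_L1_finite[OF i[OF Q'], folded p_def]
    note DS = phi_dom_density[of S] and DQ = phi_dom_density[of Q]
    have le: "(\<integral>x. p S x \<partial>P) \<le> (\<integral>x. p Q x \<partial>P)"
      using ii[OF Q'] unfolding signed_integral_def L1S(3) L1Q(3) by simp
    have "AE x in P. f (dens S x) + (p Q x - p S x) \<le> f (dens Q x)"
      using DS(3)[OF S'] DQ(3)[OF True] L1S(1) L1Q(1)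
      unfolding p_def by eventually_elim (rule tangent_products)
    then have "(\<integral>x. f (dens S x) + (p Q x - p S x) \<partial>P) \<le> (\<integral>x. f (dens Q x) \<partial>P)"
      using S True DS(4) DQ(4) L1S(2) L1Q(2) by (intro integral_mono_AE) auto
    also have "(\<integral>x. f (dens S x) + (p Q x - p S x) \<partial>P) =
        (\<integral>x. f (dens S x) \<partial>P) + ((\<integral>x. p Q x \<partial>P) - (\<integral>x. p S x \<partial>P))"
      using S DS(4) L1S(2) L1Q(2) by simp
    finally show ?thesis
      using S True le by (simp add: DS(5) DQ(5) ennreal_leI)
  qed
qed

section \<open>Necessity\<close>

text \<open>The difference quotients \<open>F n\<close> of \<open>\<phi>\<close> along the segment from \<open>S\<close> to \<open>Q\<close> have nonnegative
  integrals because \<open>S\<close> minimises the divergence on that segment, they converge almost everywhere to \<open>L\<close>, and by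
  convexity they are dominated from above by the integrable \<open>h = f (dens Q) - f (dens S)\<close>. Fatou's
  lemma for \<open>h - F n \<ge> 0\<close> bounds the integral of \<open>h - L\<close> by that of \<open>h\<close>; this gives finiteness
  almost everywhere, integrability and the sign of the integral of \<open>L\<close> at once.\<close>
lemma directional_derivative_nonneg:
  assumes conv: "convex_measure_set \<Omega>" and \<Omega>: "\<Omega> \<subseteq> signed_measures P"
    and proj: "is_phi_projection \<phi> P \<Omega> S"
    and S: "S \<in> \<Omega> \<inter> phi_dom \<phi> P" and Q: "Q \<in> \<Omega> \<inter> phi_dom \<phi> P"
    and upper: "AE x in P. ereal (dens S x) \<noteq> upper_end \<phi>"
  defines "L \<equiv> \<lambda>x. phi_deriv \<phi> (dens S x) * ereal (dens Q x - dens S x)"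
  shows "AE x in P. \<bar>L x\<bar> \<noteq> \<infinity>" "integrable P (\<lambda>x. real_of_ereal (L x))"
    "0 \<le> (\<integral>x. real_of_ereal (L x) \<partial>P)"
proof -
  \<comment> \<open>Shifted by 2 so that every step is strictly between 0 and 1.\<close>
  define t where "t n = 1 / (real n + 2)" for n
  have t: "t \<longlonglongrightarrow> 0" "\<And>n. 0 < t n" "\<And>n. t n < 1"
    using LIMSEQ_ignore_initial_segment[OF lim_1_over_n[where 'a=real], of 2] by (auto simp: t_def [abs_def] add.commute)
  define z where "z n x = (1 - t n) * dens S x + t n * dens Q x" for n x
  define F where "F n x = (f (z n x) - f (dens S x)) / t n" for n x
  define h where "h x = f (dens Q x) - f (dens S x)" for x
  have S': "S \<in> phi_dom \<phi> P" and Q': "Q \<in> phi_dom \<phi> P" using S Q by auto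
  note DS = phi_dom_density[OF S'] and DQ = phi_dom_density[OF Q']
  have [measurable]: "dens S \<in> borel_measurable P" "dens Q \<in> borel_measurable P"
    using DS(2) DQ(2) by auto
  have [measurable]: "z n \<in> borel_measurable P" "F n \<in> borel_measurable P"
    "h \<in> borel_measurable P" "L \<in> borel_measurable P" for n
    unfolding z_def F_def h_def L_def by measurable
  have int_h: "integrable P h" unfolding h_def using DS(4) DQ(4) by simp
  have z: "AE x in P. z n x \<in> dom\<phi> \<and> f (z n x) \<le> (1 - t n) * f (dens S x) + t n * f (dens Q x)" for n
    using DS(3) DQ(3)
  proof eventually_elim
    case (elim x)
    then show ?case
      unfolding z_def using t(2,3)[of n] by (intro conjI domain_convex) auto
  qed
  have F_le: "AE x in P. F n x \<le> h x" for n
    using z[of n]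
  proof eventually_elim
    case (elim x)
    then have "f (z n x) - f (dens S x) \<le> h x * t n" unfolding h_def by (simp add: algebra_simps)
    then show ?case unfolding F_def using t(2)[of n] by (simp add: divide_le_eq)
  qed
  have int_z: "integrable P (\<lambda>x. f (z n x))" for n
  proof (rule Bochner_Integration.integrable_bound)
    show "integrable P (\<lambda>x. (1 - t n) * f (dens S x) + t n * f (dens Q x))"
      using DS(4) DQ(4) by simp
    show "AE x in P. norm (f (z n x)) \<le> norm ((1 - t n) * f (dens S x) + t n * f (dens Q x))"
      using z[of n] by eventually_elim auto
  qed measurable
  have min_z: "(\<integral>x. f (dens S x) \<partial>P) \<le> (\<integral>x. f (z n x) \<partial>P)" for n
  proof -
    let ?Q = "\<lambda>A. (1 - t n) * S A + t n * Q A"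
    have in\<Omega>: "?Q \<in> \<Omega>"
      using conv S Q t(2,3)[of n] unfolding convex_measure_set_def by auto
    then have "?Q \<in> signed_measures P" using \<Omega> by auto
    note conv_dens = AE_signed_RN_deriv_convex[OF DS(1) DQ(1) this]
    have "ennreal (\<integral>x. f (dens S x) \<partial>P) \<le> phi_divergence \<phi> P ?Q"
      using proj in\<Omega> unfolding is_phi_projection_def by (simp flip: DS(5))
    also have "\<dots> = (\<integral>\<^sup>+x. \<phi> (dens ?Q x) \<partial>P)"
      using conv_dens(1) by (simp add: phi_divergence_def)
    also have "\<dots> = (\<integral>\<^sup>+x. ennreal (f (z n x)) \<partial>P)"
    proof (rule nn_integral_cong_AE, use conv_dens(2) z[of n] in eventually_elim)
      case (elim x)
      then show ?case using phi_eq[of "z n x"] by (simp only: z_def)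
    qed
    also have "\<dots> = ennreal (\<integral>x. f (z n x) \<partial>P)"
      by (rule nn_integral_eq_integral[OF int_z]) simp
    finally show ?thesis by simp
  qed
  have int_F: "integrable P (F n)" "0 \<le> (\<integral>x. F n x \<partial>P)" for n
    unfolding F_def using int_z DS(4) min_z[of n] t(2)[of n] by auto
  define C where "C = (\<integral>x. h x \<partial>P)"
  have bound: "(\<integral>\<^sup>+x. ennreal (h x - F n x) \<partial>P) \<le> ennreal C" for n
  proof -
    have "(\<integral>\<^sup>+x. ennreal (h x - F n x) \<partial>P) = ennreal (\<integral>x. h x - F n x \<partial>P)"
      by (rule nn_integral_eq_integral) (use int_h int_F F_le[of n] in auto)
    also have "\<dots> \<le> ennreal C"
      using int_h int_F[of n] unfolding C_def by (intro ennreal_leI) simp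
    finally show ?thesis .
  qed
  have F_lim: "AE x in P. (\<lambda>n. ereal (F n x)) \<longlonglongrightarrow> L x"
    using DS(3) DQ(3) upper
  proof eventually_elim
    case (elim x)
    then show ?case
      unfolding F_def z_def L_def by (intro difference_quotient_limit t)
  qed
  have F_le_all: "AE x in P. \<forall>n. F n x \<le> h x" using F_le by (simp add: AE_all_countable)
  have L_le: "AE x in P. L x \<le> ereal (h x)"
    using F_lim F_le_all
  proof eventually_elim
    case (elim x)
    then show ?case by (intro LIMSEQ_le_const2[OF elim(1)]) auto
  qed
  have "AE x in P. liminf (\<lambda>n. ennreal (h x - F n x)) = e2ennreal (ereal (h x) - L x)"
    using F_lim L_le
  proof eventually_elim
    case (elim x)
    then have "(\<lambda>n. ereal (h x) - ereal (F n x)) \<longlonglongrightarrow> ereal (h x) - L x"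
      by (intro tendsto_diff_ereal_general tendsto_const) auto
    then have "(\<lambda>n. e2ennreal (ereal (h x) - ereal (F n x))) \<longlonglongrightarrow> e2ennreal (ereal (h x) - L x)"
      by (rule tendsto_e2ennrealI)
    then show ?case by (intro lim_imp_Liminf) auto
  qed
  then have "(\<integral>\<^sup>+x. e2ennreal (ereal (h x) - L x) \<partial>P) = (\<integral>\<^sup>+x. liminf (\<lambda>n. ennreal (h x - F n x)) \<partial>P)"
    by (intro nn_integral_cong_AE) (auto elim!: eventually_mono)
  also have "\<dots> \<le> liminf (\<lambda>n. \<integral>\<^sup>+x. ennreal (h x - F n x) \<partial>P)"
    by (rule nn_integral_liminf) measurable
  also have "\<dots> \<le> ennreal C"
    using Liminf_mono[of "\<lambda>n. \<integral>\<^sup>+x. ennreal (h x - F n x) \<partial>P" "\<lambda>_. ennreal C" sequentially] bound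
    by (simp add: Liminf_const)
  finally have le_C: "(\<integral>\<^sup>+x. e2ennreal (ereal (h x) - L x) \<partial>P) \<le> ennreal C" .
  then have "(\<integral>\<^sup>+x. e2ennreal (ereal (h x) - L x) \<partial>P) \<noteq> \<infinity>" by (auto simp: top_unique)
  then have "AE x in P. e2ennreal (ereal (h x) - L x) \<noteq> \<infinity>"
    by (intro nn_integral_PInf_AE) measurable
  with L_le show fin: "AE x in P. \<bar>L x\<bar> \<noteq> \<infinity>"
  proof eventually_elim
    case (elim x)
    then show ?case by (cases "L x") auto
  qed
  define l where "l x = real_of_ereal (L x)" for x
  have [measurable]: "l \<in> borel_measurable P" unfolding l_def by measurable
  have l_le: "AE x in P. 0 \<le> h x - l x"
    using fin L_le
  proof eventually_elim
    case (elim x)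
    then show ?case by (cases "L x") (auto simp: l_def)
  qed
  have "(\<integral>\<^sup>+x. e2ennreal (ereal (h x) - L x) \<partial>P) = (\<integral>\<^sup>+x. ennreal (h x - l x) \<partial>P)"
  proof (rule nn_integral_cong_AE, use fin in eventually_elim)
    case (elim x)
    then show ?case by (cases "L x") (auto simp: l_def)
  qed
  then have le_C': "(\<integral>\<^sup>+x. ennreal (h x - l x) \<partial>P) \<le> ennreal C" using le_C by simp
  have int_hl: "integrable P (\<lambda>x. h x - l x)"
    by (rule integrableI_nonneg) (use l_le le_C' in \<open>auto intro: le_less_trans\<close>)
  have int_l: "integrable P l"
    using Bochner_Integration.integrable_diff[OF int_h int_hl] by simp
  then show "integrable P (\<lambda>x. real_of_ereal (L x))" by (simp add: l_def[abs_def])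
  have "0 \<le> C"
    using integral_mono_AE[OF int_F(1) int_h F_le, of 0] int_F(2)[of 0] unfolding C_def by simp
  moreover have "ennreal (\<integral>x. h x - l x \<partial>P) \<le> ennreal C"
    using le_C' nn_integral_eq_integral[OF int_hl l_le] by simp
  ultimately have "(\<integral>x. h x - l x \<partial>P) \<le> C" by (simp add: ennreal_le_iff)
  then show "0 \<le> (\<integral>x. real_of_ereal (L x) \<partial>P)"
    using int_h int_l unfolding C_def l_def by simp
qed

lemma growth_bound:
  assumes growth: "\<And>x. enn2ereal (\<phi> (c * x))
      \<le> ereal c1 * enn2ereal (\<phi> x) + ereal c2 * ereal \<bar>x\<bar> + ereal c3"
    and x: "x \<in> dom\<phi>"
  shows "c * x \<in> dom\<phi>" "f (c * x) \<le> c1 * f x + c2 * \<bar>x\<bar> + c3"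
proof -
  have "enn2ereal (\<phi> (c * x)) \<le> ereal (c1 * f x + c2 * \<bar>x\<bar> + c3)"
    using growth[of x] by (subst (asm) phi_eq[OF x]) (simp add: enn2ereal_ennreal)
  then show "c * x \<in> dom\<phi>" "f (c * x) \<le> c1 * f x + c2 * \<bar>x\<bar> + c3"
    by (cases "\<phi> (c * x)"; auto simp: eff_domain_def enn2ereal_ennreal)+
qed

lemma scaling_upper_end:
  assumes "0 < \<delta>" "(1 + \<delta>) * x \<in> dom\<phi>"
  shows "ereal x \<noteq> upper_end \<phi>"
proof
  assume x: "ereal x = upper_end \<phi>"
  have "1 < upper_end \<phi>" using divergence by (simp add: divergence_function_def)
  then have "1 < x" by (simp flip: x add: one_ereal_def)
  moreover have "(1 + \<delta>) * x \<le> x" using domain_bounds(2)[OF assms(2)] by (simp flip: x)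
  ultimately show False using assms(1) by (simp add: algebra_simps mult_le_0_iff)
qed

text \<open>A domain that contains both multiples of its endpoint \<open>x\<close> cannot lie on one side of \<open>x\<close> unless
  \<open>x = 0\<close>. So, under the growth condition, the slope is finite at every nonzero point of the domain.\<close>
lemma scaling_phi_deriv_infinite:
  assumes \<delta>: "0 < \<delta>" and x: "x \<in> dom\<phi>" "(1 + \<delta>) * x \<in> dom\<phi>" "(1 - \<delta>) * x \<in> dom\<phi>"
    and inf: "\<bar>phi_deriv \<phi> x\<bar> = \<infinity>"
  shows "x = 0"
proof -
  have "ereal x = lower_end \<phi>"
    using phi_deriv_infinite_at_end[OF x(1) inf] scaling_upper_end[OF \<delta> x(2)] by blast
  then have "x \<le> (1 + \<delta>) * x" "x \<le> (1 - \<delta>) * x"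
    using domain_bounds(1)[OF x(2)] domain_bounds(1)[OF x(3)] by (metis ereal_less_eq(3))+
  then have "\<delta> * x = 0" by (simp add: algebra_simps)
  then show ?thesis using \<delta> by simp
qed

text \<open>The tangent at \<open>x\<close> evaluated at \<open>(1 + \<delta>) * x\<close> and at \<open>(1 - \<delta>) * x\<close> bounds the slope times
  \<open>x\<close> from above and from below.\<close>
lemma scaling_bound:
  assumes \<delta>: "0 < \<delta>" and x: "x \<in> dom\<phi>" "(1 + \<delta>) * x \<in> dom\<phi>" "(1 - \<delta>) * x \<in> dom\<phi>"
  shows "\<bar>real_of_ereal (phi_deriv \<phi> x) * x\<bar> \<le> (f ((1 + \<delta>) * x) + f ((1 - \<delta>) * x)) / \<delta>"
proof (cases "\<bar>phi_deriv \<phi> x\<bar> = \<infinity>")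
  case True
  then show ?thesis using scaling_phi_deriv_infinite[OF assms] \<delta> by auto
next
  case False
  let ?w = "real_of_ereal (phi_deriv \<phi> x) * x"
  have "f x + \<delta> * ?w \<le> f ((1 + \<delta>) * x)" "f x - \<delta> * ?w \<le> f ((1 - \<delta>) * x)"
    using tangent[OF x(1) x(2) False] tangent[OF x(1) x(3) False] by (simp_all add: algebra_simps)
  moreover have "0 \<le> f x" "0 \<le> f ((1 + \<delta>) * x)" "0 \<le> f ((1 - \<delta>) * x)" by simp_all
  ultimately have "\<bar>\<delta> * ?w\<bar> \<le> f ((1 + \<delta>) * x) + f ((1 - \<delta>) * x)"
    by linarith
  then have "\<delta> * \<bar>?w\<bar> \<le> f ((1 + \<delta>) * x) + f ((1 - \<delta>) * x)"
    using \<delta> by (simp add: abs_mult)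
  then show ?thesis using \<delta> by (simp add: le_divide_eq mult.commute)
qed

text \<open>Write \<open>g\<close> for the slope of \<open>\<phi>\<close> at \<open>dens S\<close>. The growth condition makes \<open>g * dens S\<close>
  integrable, and \<open>g * (dens Q - dens S)\<close> is integrable with nonnegative integral; add the two. Where \<open>g\<close>
  is infinite, \<open>dens S\<close> vanishes, and almost everywhere \<open>dens Q\<close> does as well since
  \<open>g * (dens Q - dens S)\<close> is finite there.\<close>
lemma necessary_for_projection:
  assumes conv: "convex_measure_set \<Omega>" and \<Omega>: "\<Omega> \<subseteq> signed_measures P"
    and \<delta>: "0 < \<delta>"
    and growth: "\<And>c. c \<in> {1 - \<delta>, 1 + \<delta>} \<Longrightarrow> \<exists>c\<^sub>1 c\<^sub>2 c\<^sub>3 :: real. \<forall>x::real.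
        enn2ereal (\<phi> (c * x)) \<le> ereal c\<^sub>1 * enn2ereal (\<phi> x) + ereal c\<^sub>2 * ereal \<bar>x\<bar> + ereal c\<^sub>3"
    and proj: "is_phi_projection \<phi> P \<Omega> S"
    and S: "S \<in> \<Omega> \<inter> phi_dom \<phi> P" and Q: "Q \<in> \<Omega> \<inter> phi_dom \<phi> P"
  shows "ext_L1 P (\<lambda>x. phi_deriv \<phi> (dens S x) * ereal (dens Q x))"
    "signed_integral P S (\<lambda>x. phi_deriv \<phi> (dens S x)) \<le> signed_integral P Q (\<lambda>x. phi_deriv \<phi> (dens S x))"
proof -
  have S': "S \<in> phi_dom \<phi> P" and Q': "Q \<in> phi_dom \<phi> P" using S Q by auto
  note DS = phi_dom_density[OF S'] and DQ = phi_dom_density[OF Q']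
  have [measurable]: "dens S \<in> borel_measurable P" "dens Q \<in> borel_measurable P"
    using DS(2) DQ(2) by auto
  have scaled: "(AE x in P. c * dens S x \<in> dom\<phi>) \<and> integrable P (\<lambda>x. f (c * dens S x))"
    if c: "c \<in> {1 - \<delta>, 1 + \<delta>}" for c
  proof -
    obtain c1 c2 c3 where b: "\<And>x. enn2ereal (\<phi> (c * x))
        \<le> ereal c1 * enn2ereal (\<phi> x) + ereal c2 * ereal \<bar>x\<bar> + ereal c3"
      using growth[OF c] by blast
    have "AE x in P. norm (f (c * dens S x)) \<le> norm (c1 * f (dens S x) + c2 * \<bar>dens S x\<bar> + c3)"
      using DS(3)
    proof eventually_elim
      case (elim x)
      have "f (c * dens S x) \<le> c1 * f (dens S x) + c2 * \<bar>dens S x\<bar> + c3"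
        by (rule growth_bound(2)[OF b elim])
      moreover have "0 \<le> f (c * dens S x)" by simp
      ultimately show ?case unfolding real_norm_def by linarith
    qed
    then have "integrable P (\<lambda>x. f (c * dens S x))"
      by (rule Bochner_Integration.integrable_bound[rotated 2]) (use DS(2,4) in auto)
    moreover have "AE x in P. c * dens S x \<in> dom\<phi>"
      using DS(3) by eventually_elim (rule growth_bound(1)[OF b])
    ultimately show ?thesis by blast
  qed
  have up: "AE x in P. (1 + \<delta>) * dens S x \<in> dom\<phi>" "integrable P (\<lambda>x. f ((1 + \<delta>) * dens S x))"
    using scaled[of "1 + \<delta>"] by auto
  have down: "AE x in P. (1 - \<delta>) * dens S x \<in> dom\<phi>" "integrable P (\<lambda>x. f ((1 - \<delta>) * dens S x))"
    using scaled[of "1 - \<delta>"] by auto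
  have upper: "AE x in P. ereal (dens S x) \<noteq> upper_end \<phi>"
    using up(1) by eventually_elim (rule scaling_upper_end[OF \<delta>])
  define g where "g x = phi_deriv \<phi> (dens S x)" for x
  \<comment> \<open>Equal to 0 where \<open>g\<close> is infinite; both densities vanish there, so the products are still right.\<close>
  define r where "r x = real_of_ereal (g x)" for x
  have [measurable]: "g \<in> borel_measurable P" "r \<in> borel_measurable P"
    unfolding g_def r_def by measurable
  have g_inf: "AE x in P. \<bar>g x\<bar> = \<infinity> \<longrightarrow> dens S x = 0"
    using DS(3) up(1) down(1)
    by eventually_elim (auto simp: g_def intro: scaling_phi_deriv_infinite[OF \<delta>])
  have int_S: "integrable P (\<lambda>x. r x * dens S x)"
  proof (rule Bochner_Integration.integrable_bound)
    show "integrable P (\<lambda>x. (f ((1 + \<delta>) * dens S x) + f ((1 - \<delta>) * dens S x)) / \<delta>)"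
      using up(2) down(2) by simp
    show "AE x in P. norm (r x * dens S x) \<le> norm ((f ((1 + \<delta>) * dens S x) + f ((1 - \<delta>) * dens S x)) / \<delta>)"
      using DS(3) up(1) down(1)
    proof eventually_elim
      case (elim x)
      show ?case
        using scaling_bound[OF \<delta> elim] \<delta> unfolding r_def g_def real_norm_def by linarith
    qed
  qed measurable
  note dir = directional_derivative_nonneg[OF conv \<Omega> proj S Q upper, folded g_def]
  let ?l = "\<lambda>x. real_of_ereal (g x * ereal (dens Q x - dens S x))"
  have cases_g: "AE x in P. \<bar>g x\<bar> \<noteq> \<infinity> \<or> dens S x = 0 \<and> dens Q x = 0"
    using g_inf dir(1)
  proof eventually_elim
    case (elim x)
    then show ?case by (cases "g x"; auto split: if_splits)
  qed
  have eqS: "AE x in P. g x * ereal (dens S x) = ereal (r x * dens S x)"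
    using cases_g
  proof eventually_elim
    case (elim x)
    then show ?case by (cases "g x") (auto simp: r_def zero_ereal_def[symmetric])
  qed
  have eqQ: "AE x in P. g x * ereal (dens Q x) = ereal (?l x + r x * dens S x)"
    using cases_g
  proof eventually_elim
    case (elim x)
    then show ?case by (cases "g x") (auto simp: r_def algebra_simps)
  qed
  have int_Q: "integrable P (\<lambda>x. ?l x + r x * dens S x)" using dir(2) int_S by simp
  show "ext_L1 P (\<lambda>x. phi_deriv \<phi> (dens S x) * ereal (dens Q x))"
    unfolding g_def[symmetric] by (rule ext_L1_AE_real[OF int_Q _ eqQ]) measurable
  show "signed_integral P S (\<lambda>x. phi_deriv \<phi> (dens S x)) \<le> signed_integral P Q (\<lambda>x. phi_deriv \<phi> (dens S x))"
    unfolding g_def[symmetric] signed_integral_def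
      ext_integral_AE_real[OF int_S eqS] ext_integral_AE_real[OF int_Q eqQ]
    using dir(2,3) int_S by simp
qed

end

theorem theorem3p5:
  fixes P :: "'a measure"
    and \<phi> :: "real \<Rightarrow> ennreal"
    and \<Omega> :: "('a set \<Rightarrow> real) set"
    and Qstar :: "'a set \<Rightarrow> real"
  assumes "prob_space P"
    and "divergence_function \<phi>"
    and "differentiable_divergence \<phi>"
    and "\<Omega> \<subseteq> signed_measures P"
    and "Qstar \<in> \<Omega> \<inter> phi_dom \<phi> P"
  defines "g \<equiv> (\<lambda>x. phi_deriv \<phi> (signed_RN_deriv P Qstar x))"
  shows "((\<forall>Q\<in>\<Omega> \<inter> phi_dom \<phi> P.
              ext_L1 P (\<lambda>x. g x * ereal (signed_RN_deriv P Q x))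
              \<and> signed_integral P Qstar g \<le> signed_integral P Q g)
            \<longrightarrow> is_phi_projection \<phi> P \<Omega> Qstar)
       \<and> (convex_measure_set \<Omega>
          \<and> (\<exists>\<delta>::real. 0 < \<delta> \<and> \<delta> < 1 \<and>
               (\<forall>c\<in>{1 - \<delta>..1 + \<delta>}. \<exists>c\<^sub>1 c\<^sub>2 c\<^sub>3 :: real. \<forall>x::real.
                  enn2ereal (\<phi> (c * x))
                    \<le> ereal c\<^sub>1 * enn2ereal (\<phi> x) + ereal c\<^sub>2 * ereal \<bar>x\<bar> + ereal c\<^sub>3))
          \<longrightarrow> is_phi_projection \<phi> P \<Omega> Qstar
          \<longrightarrow> (\<forall>Q\<in>\<Omega> \<inter> phi_dom \<phi> P.
                ext_L1 P (\<lambda>x. g x * ereal (signed_RN_deriv P Q x))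
                \<and> signed_integral P Qstar g \<le> signed_integral P Q g))"
proof -
  interpret smooth_divergence_space \<phi> P
    using assms(1-3) by (simp add: smooth_divergence_space_def smooth_divergence_def)
  show ?thesis
  proof (intro conjI impI ballI, goal_cases)
    case 1
    then show ?case
      unfolding g_def by (intro sufficient_for_projection[OF assms(4,5)]) auto
  next
    case (2 Q)
    then obtain \<delta> :: real where \<delta>: "0 < \<delta>" and growth: "\<And>c. c \<in> {1 - \<delta>..1 + \<delta>} \<Longrightarrow>
        \<exists>c\<^sub>1 c\<^sub>2 c\<^sub>3 :: real. \<forall>x::real. enn2ereal (\<phi> (c * x))
          \<le> ereal c\<^sub>1 * enn2ereal (\<phi> x) + ereal c\<^sub>2 * ereal \<bar>x\<bar> + ereal c\<^sub>3"
      by blast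
    from 2 \<delta> show ?case
      unfolding g_def by (intro necessary_for_projection(1)[OF _ assms(4) \<delta> growth _ assms(5)]) auto
  next
    case (3 Q)
    then obtain \<delta> :: real where \<delta>: "0 < \<delta>" and growth: "\<And>c. c \<in> {1 - \<delta>..1 + \<delta>} \<Longrightarrow>
        \<exists>c\<^sub>1 c\<^sub>2 c\<^sub>3 :: real. \<forall>x::real. enn2ereal (\<phi> (c * x))
          \<le> ereal c\<^sub>1 * enn2ereal (\<phi> x) + ereal c\<^sub>2 * ereal \<bar>x\<bar> + ereal c\<^sub>3"
      by blast
    from 3 \<delta> show ?case
      unfolding g_def by (intro necessary_for_projection(2)[OF _ assms(4) \<delta> growth _ assms(5)]) auto
  qed
qed

end
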